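(* Let $\mathcal{S}$ be either of the following sub-semigroups of $\mathcal{P}$: (i) $\mathcal{S} = \mathcal{P}$ itself; (ii) $\mathcal{S} = \mathcal{P}^p$ for some real $p$ with $0 < p < 1$. Then the only monotone additive statistic $\varphi \colon \mathcal{S} \to \mathbb{R}$ is $\varphi = 0$.
   Context: $\mathcal{P}$ is the set of Borel probability measures on $\mathbb{R}$, a commutative semigroup under convolution $\ast$. A sub-semigroup of $\mathcal{P}$ is a subset closed under convolution. Stochastic order: $\mu \le \nu$ if and only if $\mu((-\infty,x]) \ge \nu((-\infty,x])$ for all $x \in \mathbb{R}$. For a sub-semigroup $\mathcal{S} \subseteq \mathcal{P}$, a map $\varphi \colon \mathcal{S} \to \mathbb{R}$ is an additive statistic if $\varphi(\mu \ast \nu) = \varphi(\mu) + \varphi(\nu)$ for all $\mu,\nu \in \mathcal{S}$. It is monotone if $\mu \le \nu$ implies $\varphi(\mu) \le \varphi(\nu)$ for all $\mu,\nu\in\mathcal{S}$. A monotone additive statistic on $\mathcal{S}$ is a map with both properties; no continuity or measurability is assumed. For $0 < p < \infty$, $\mathcal{P}^p$ is the sub-semigroup of all $\mu \in \mathcal{P}$ with $\int |x|^p \, \mathrm{d}\mu(x) < \infty$. *)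

theory Defs
  imports "HOL-Probability.Probability"
begin

definition borel_probs :: "real measure set" where
  "borel_probs = {\<mu>. real_distribution \<mu>}"

definition borel_probs_moment :: "real \<Rightarrow> real measure set" where
  "borel_probs_moment p = {\<mu> \<in> borel_probs. (\<integral>\<^sup>+x. ennreal (\<bar>x\<bar> powr p) \<partial>\<mu>) < \<infinity>}"

definition sub_semigroup :: "real measure set \<Rightarrow> bool" where
  "sub_semigroup S \<longleftrightarrow> S \<subseteq> borel_probs \<and> (\<forall>\<mu>\<in>S. \<forall>\<nu>\<in>S. convolution \<mu> \<nu> \<in> S)"

definition stochastic_le :: "real measure \<Rightarrow> real measure \<Rightarrow> bool" where
  "stochastic_le \<mu> \<nu> \<longleftrightarrow> (\<forall>x. cdf \<mu> x \<ge> cdf \<nu> x)"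

(* A statistic on S is represented by a total function of which only the values on S matter. *)

definition additive_statistic :: "real measure set \<Rightarrow> (real measure \<Rightarrow> real) \<Rightarrow> bool" where
  "additive_statistic S \<phi> \<longleftrightarrow> (\<forall>\<mu>\<in>S. \<forall>\<nu>\<in>S. \<phi> (convolution \<mu> \<nu>) = \<phi> \<mu> + \<phi> \<nu>)"

definition monotone_statistic :: "real measure set \<Rightarrow> (real measure \<Rightarrow> real) \<Rightarrow> bool" where
  "monotone_statistic S \<phi> \<longleftrightarrow> (\<forall>\<mu>\<in>S. \<forall>\<nu>\<in>S. stochastic_le \<mu> \<nu> \<longrightarrow> \<phi> \<mu> \<le> \<phi> \<nu>)"

definition monotone_additive_statistic :: "real measure set \<Rightarrow> (real measure \<Rightarrow> real) \<Rightarrow> bool" where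
  "monotone_additive_statistic S \<phi> \<longleftrightarrow> monotone_statistic S \<phi> \<and> additive_statistic S \<phi>"

lemma convolution_in_borel_probs:
  assumes "\<mu> \<in> borel_probs" "\<nu> \<in> borel_probs"
  shows "convolution \<mu> \<nu> \<in> borel_probs"
proof -
  interpret M: real_distribution \<mu> using assms by (simp add: borel_probs_def)
  interpret N: real_distribution \<nu> using assms by (simp add: borel_probs_def)
  interpret P: pair_prob_space \<mu> \<nu> ..
  show ?thesis
    unfolding borel_probs_def convolution_def mem_Collect_eq
    by (rule P.real_distribution_distr) measurable
qed

lemma sub_semigroup_borel_probs: "sub_semigroup borel_probs"
  by (simp add: sub_semigroup_def convolution_in_borel_probs)

lemma sub_semigroup_borel_probs_moment:
  assumes "0 < p"
  shows "sub_semigroup (borel_probs_moment p)"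
  unfolding sub_semigroup_def
proof (intro conjI ballI)
  show "borel_probs_moment p \<subseteq> borel_probs"
    by (auto simp: borel_probs_moment_def)
  fix \<mu> \<nu> assume "\<mu> \<in> borel_probs_moment p" "\<nu> \<in> borel_probs_moment p"
  then have P: "\<mu> \<in> borel_probs" "\<nu> \<in> borel_probs"
    and fin: "(\<integral>\<^sup>+x. ennreal (\<bar>x\<bar> powr p) \<partial>\<mu>) < \<infinity>" "(\<integral>\<^sup>+x. ennreal (\<bar>x\<bar> powr p) \<partial>\<nu>) < \<infinity>"
    by (auto simp: borel_probs_moment_def)
  interpret M: real_distribution \<mu> using P by (simp add: borel_probs_def)
  interpret N: real_distribution \<nu> using P by (simp add: borel_probs_def)
  define c where "c = ennreal (2 powr p)"
  have bound: "ennreal (\<bar>x + y\<bar> powr p) \<le> c * ennreal (\<bar>x\<bar> powr p) + c * ennreal (\<bar>y\<bar> powr p)"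
    for x y :: real
  proof -
    have "\<bar>x + y\<bar> powr p \<le> (2 * max \<bar>x\<bar> \<bar>y\<bar>) powr p"
      using assms by (intro powr_mono2) auto
    also have "\<dots> = 2 powr p * max \<bar>x\<bar> \<bar>y\<bar> powr p"
      by (simp add: powr_mult)
    also have "\<dots> \<le> 2 powr p * (\<bar>x\<bar> powr p + \<bar>y\<bar> powr p)"
      by (intro mult_left_mono) (auto simp: max_def)
    finally show ?thesis
      by (simp add: c_def ennreal_mult[symmetric] ennreal_plus[symmetric] distrib_left
          del: ennreal_plus)
  qed
  have "(\<integral>\<^sup>+z. ennreal (\<bar>z\<bar> powr p) \<partial>convolution \<mu> \<nu>)
      = (\<integral>\<^sup>+x. \<integral>\<^sup>+y. ennreal (\<bar>x + y\<bar> powr p) \<partial>\<nu> \<partial>\<mu>)"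
    by (rule nn_integral_convolution)
      (auto intro: M.finite_measure_axioms N.finite_measure_axioms)
  also have "\<dots> \<le> (\<integral>\<^sup>+x. \<integral>\<^sup>+y. c * ennreal (\<bar>x\<bar> powr p) + c * ennreal (\<bar>y\<bar> powr p) \<partial>\<nu> \<partial>\<mu>)"
    by (intro nn_integral_mono bound)
  also have "\<dots> = c * (\<integral>\<^sup>+x. ennreal (\<bar>x\<bar> powr p) \<partial>\<mu>) + c * (\<integral>\<^sup>+y. ennreal (\<bar>y\<bar> powr p) \<partial>\<nu>)"
    by (simp add: nn_integral_add nn_integral_cmult M.emeasure_space_1 N.emeasure_space_1
        del: M.space_eq_univ N.space_eq_univ)
  also have "\<dots> < \<infinity>"
    using fin by (simp add: c_def ennreal_mult_less_top)
  finally show "convolution \<mu> \<nu> \<in> borel_probs_moment p"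
    using convolution_in_borel_probs[OF P] by (simp add: borel_probs_moment_def)
qed

end

theory Submission
  imports Defs "HOL-Real_Asymp.Real_Asymp"
begin

text \<open>
  Let \<open>\<phi>\<close> be a monotone additive statistic on the laws with finite \<open>p\<close>-th absolute moment,
  \<open>0 \<le> p < 1\<close>; the case \<open>p = 0\<close> is the semigroup of all laws (\<open>borel_probs_eq_moment_0\<close>).
  The source of rigidity is that \<open>\<phi>\<close> takes finite values, while for \<open>p < 1\<close> the function
  \<open>\<bar>x\<bar> powr p\<close> is subadditive, even over infinite sums. Hence, if laws \<open>\<mu> i\<close> on the nonnegative
  reals have summable \<open>p\<close>-th moments, the sum of independent variables with these laws converges
  and again has a finite moment. Its law dominates each finite convolution of the \<open>\<mu> i\<close>, so a
  common lower bound \<open>a\<close> of the \<open>\<phi> (\<mu> i)\<close> would give it a statistic of at least \<open>n * a\<close> for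
  every \<open>n\<close>; therefore \<open>a \<le> 0\<close> (\<open>statistic_bound_of_summable_moments\<close>). This principle is
  used twice.

  Constants. A law that has the large value \<open>s\<close> with the small probability \<open>9 * a / s\<close>, and is 0
  otherwise, does not dominate the constant \<open>a > 0\<close>, but its mean is \<open>9 * a\<close>, and it does
  dominate \<open>a\<close> after an independent Laplace variable of scale \<open>s\<close> is added to
  both (\<open>two_point_dominates_with_noise\<close>). Additivity cancels the noise, so the statistic of
  \<open>a\<close> is a lower bound for that of each two-point law. As \<open>s\<close> grows geometrically, the moments,
  of order \<open>s powr (p - 1)\<close>, are summable because \<open>p < 1\<close>, so \<open>\<phi>\<close> is nonpositive at \<open>a\<close>.

  General laws. For \<open>M > 0\<close>, replacing a variable \<open>X\<close> by 0 wherever \<open>X \<le> M\<close> and then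
  adding the constant \<open>M\<close> can only increase it. As constants contribute nothing positive, the part of \<open>X\<close> above \<open>M\<close> has
  at least the statistic of \<open>X\<close>, and its moment tends to 0 as \<open>M\<close> grows. A sequence of such
  parts with summable moments shows that \<open>\<phi>\<close> is nonpositive at \<open>X\<close> (\<open>statistic_nonpos\<close>).
  The same bound for the statistic \<open>\<mu> \<mapsto> - \<phi> (reflect \<mu>)\<close> gives the opposite inequality.
\<close>

section \<open>Moments of order below one\<close>

lemma real_distribution_moment:
  "\<mu> \<in> borel_probs_moment p \<Longrightarrow> real_distribution \<mu>"
  by (simp add: borel_probs_moment_def borel_probs_def)

lemma distr_in_borel_probs_moment:
  assumes "prob_space M" and X: "X \<in> borel_measurable M"
    and "(\<integral>\<^sup>+\<omega>. ennreal (\<bar>X \<omega>\<bar> powr p) \<partial>M) < \<infinity>"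
  shows "distr M borel X \<in> borel_probs_moment p"
proof -
  have "real_distribution (distr M borel X)"
    using assms(1) X by (simp add: prob_space.real_distribution_distr)
  then show ?thesis
    using assms by (simp add: borel_probs_moment_def borel_probs_def nn_integral_distr)
qed

text \<open>
  Since \<open>0 powr 0 = 0\<close>, the moment of order 0 is the probability of the nonzero reals. It is
  finite for every law, and so the class of all laws is the case \<open>p = 0\<close> of the moment classes.
\<close>

lemma borel_probs_eq_moment_0: "borel_probs = borel_probs_moment 0"
proof -
  have "(\<integral>\<^sup>+x. ennreal (\<bar>x\<bar> powr 0) \<partial>\<mu>) < \<infinity>" if "\<mu> \<in> borel_probs" for \<mu>
  proof -
    interpret real_distribution \<mu> using that by (simp add: borel_probs_def)
    have "(\<integral>\<^sup>+x. ennreal (\<bar>x\<bar> powr 0) \<partial>\<mu>) \<le> (\<integral>\<^sup>+x. 1 \<partial>\<mu>)"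
      by (intro nn_integral_mono) simp
    also have "\<dots> < \<infinity>" by (simp add: emeasure_eq_measure)
    finally show ?thesis .
  qed
  then show ?thesis by (auto simp: borel_probs_moment_def)
qed

lemma return_in_moment: "return borel a \<in> borel_probs_moment p"
  by (simp add: borel_probs_moment_def borel_probs_def real_distribution_def
      real_distribution_axioms_def prob_space_return nn_integral_return)

lemma powr_le_1_imp_le_powr:
  fixes x p :: real
  assumes "0 \<le> x" "x \<le> 1" "0 \<le> p" "p < 1"
  shows "x \<le> x powr p"
proof (cases "x = 0")
  case False
  then have "x powr 1 \<le> x powr p" using assms by (intro powr_mono') auto
  then show ?thesis using False assms by simp
qed simp

text \<open>
  Almost all terms of a summable series of powers are below 1, and a number in the unit interval
  is at most its \<open>p\<close>-th power.
\<close>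

lemma summable_of_summable_powr:
  fixes x :: "nat \<Rightarrow> real"
  assumes p: "0 \<le> p" "p < 1" and nonneg: "\<And>i. 0 \<le> x i"
    and sum: "summable (\<lambda>i. x i powr p)"
  shows "summable x"
proof -
  have "eventually (\<lambda>i. x i powr p < 1) sequentially"
    using summable_LIMSEQ_zero[OF sum] by (rule order_tendstoD) simp
  then have "eventually (\<lambda>i. norm (x i) \<le> x i powr p) sequentially"
  proof eventually_elim
    case (elim i)
    have "x i \<le> 1"
    proof (rule ccontr)
      assume "\<not> x i \<le> 1"
      then have "1 \<le> x i powr p" using p by (simp add: ge_one_powr_ge_zero)
      with elim show False by simp
    qed
    then show ?case using powr_le_1_imp_le_powr[of "x i" p] p nonneg[of i] by simp
  qed
  then show ?thesis using sum by (rule summable_comparison_test_ev)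
qed

text \<open>
  Dividing by the total makes every term a number in the unit interval, hence at most its
  \<open>p\<close>-th power, and makes the terms add up to 1.
\<close>

lemma suminf_powr_le:
  fixes x :: "nat \<Rightarrow> real"
  assumes p: "0 \<le> p" "p < 1" and nonneg: "\<And>i. 0 \<le> x i"
    and sum: "summable (\<lambda>i. x i powr p)"
  shows "(\<Sum>i. x i) powr p \<le> (\<Sum>i. x i powr p)"
proof -
  have sx: "summable x" using summable_of_summable_powr[OF assms] .
  define T where "T = (\<Sum>i. x i)"
  have "0 \<le> T" unfolding T_def by (intro suminf_nonneg sx nonneg)
  show ?thesis
  proof (cases "T = 0")
    case True
    then show ?thesis unfolding T_def using sum by (simp add: suminf_nonneg)
  next
    case False
    with \<open>0 \<le> T\<close> have "T > 0" by simp
    have le: "x i / T \<le> x i powr p / T powr p" for i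
    proof -
      have "x i \<le> T" using sum_le_suminf[OF sx, of "{i}"] nonneg by (simp add: T_def)
      then have "x i / T \<le> (x i / T) powr p"
        using \<open>T > 0\<close> p nonneg[of i] by (intro powr_le_1_imp_le_powr) auto
      then show ?thesis using \<open>T > 0\<close> nonneg[of i] by (simp add: powr_divide)
    qed
    have "1 = (\<Sum>i. x i / T)"
      using \<open>T > 0\<close> suminf_divide[OF sx, of T] by (simp add: T_def)
    also have "\<dots> \<le> (\<Sum>i. x i powr p / T powr p)"
      by (intro suminf_le le summable_divide sx sum)
    also have "\<dots> = (\<Sum>i. x i powr p) / T powr p"
      by (rule suminf_divide[OF sum])
    finally show ?thesis using \<open>T > 0\<close> by (simp add: T_def field_simps)
  qed
qed

section \<open>Stochastic order and convolution\<close>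

lemma stochastic_le_coupling:
  assumes "prob_space M" and [measurable]: "X \<in> borel_measurable M" "Y \<in> borel_measurable M"
    and "AE \<omega> in M. X \<omega> \<le> Y \<omega>"
  shows "stochastic_le (distr M borel X) (distr M borel Y)"
  unfolding stochastic_le_def
proof
  fix t
  interpret prob_space M by fact
  have "measure M {\<omega>\<in>space M. Y \<omega> \<le> t} \<le> measure M {\<omega>\<in>space M. X \<omega> \<le> t}"
    using assms(4) by (intro finite_measure_mono_AE) auto
  moreover have "cdf (distr M borel Z) t = measure M {\<omega>\<in>space M. Z \<omega> \<le> t}"
    if [measurable]: "Z \<in> borel_measurable M" for Z
    by (simp add: cdf_def measure_distr vimage_def Int_def conj_commute)
  ultimately show "cdf (distr M borel Y) t \<le> cdf (distr M borel X) t" by simp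
qed

lemma emeasure_convolution_atMost:
  assumes "real_distribution \<mu>" "real_distribution \<nu>"
  shows "emeasure (convolution \<mu> \<nu>) {..t} = (\<integral>\<^sup>+x. ennreal (cdf \<nu> (t - x)) \<partial>\<mu>)"
proof -
  interpret M: real_distribution \<mu> by fact
  interpret N: real_distribution \<nu> by fact
  have "emeasure (convolution \<mu> \<nu>) {..t} = (\<integral>\<^sup>+x. emeasure \<nu> {a. a + x \<in> {..t}} \<partial>\<mu>)"
    using M.finite_measure_axioms N.finite_measure_axioms
    by (intro convolution_emeasure) auto
  also have "\<dots> = (\<integral>\<^sup>+x. ennreal (cdf \<nu> (t - x)) \<partial>\<mu>)"
  proof (rule nn_integral_cong)
    fix x
    have "{a. a + x \<in> {..t}} = {..t - x}" by auto
    then show "emeasure \<nu> {a. a + x \<in> {..t}} = ennreal (cdf \<nu> (t - x))"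
      by (simp add: cdf_def N.emeasure_eq_measure)
  qed
  finally show ?thesis .
qed

lemma borel_measurable_cdf:
  assumes "real_distribution \<nu>"
  shows "cdf \<nu> \<in> borel_measurable borel"
proof -
  interpret real_distribution \<nu> by fact
  show ?thesis
    by (rule borel_measurable_mono) (auto simp: mono_def intro: cdf_nondecreasing)
qed

lemma cdf_convolution_return:
  assumes "real_distribution \<nu>"
  shows "cdf (convolution (return borel a) \<nu>) t = cdf \<nu> (t - a)"
proof -
  interpret real_distribution \<nu> by fact
  note [measurable] = borel_measurable_cdf[OF assms]
  have R: "real_distribution (return borel a)"
    by (simp add: real_distribution_def real_distribution_axioms_def prob_space_return)
  have "emeasure (convolution (return borel a) \<nu>) {..t} = ennreal (cdf \<nu> (t - a))"
    by (simp add: emeasure_convolution_atMost[OF R assms])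
       (subst nn_integral_return, auto)
  then show ?thesis by (simp add: cdf_def2 measure_def)
qed

definition two_point :: "real \<Rightarrow> real \<Rightarrow> real measure" where
  "two_point q b = distr (measure_pmf (bernoulli_pmf q)) borel (\<lambda>c. if c then b else 0)"

lemma real_distribution_two_point: "real_distribution (two_point q b)"
  unfolding two_point_def
  by (rule prob_space.real_distribution_distr) (auto intro: measure_pmf.prob_space_axioms)

lemma nn_integral_two_point:
  assumes "f \<in> borel_measurable borel" "0 \<le> q" "q \<le> 1"
  shows "(\<integral>\<^sup>+x. f x \<partial>two_point q b) = f b * ennreal q + f 0 * ennreal (1 - q)"
  using assms by (simp add: two_point_def nn_integral_distr)

lemma nn_integral_two_point_powr:
  assumes "0 \<le> q" "q \<le> 1"
  shows "(\<integral>\<^sup>+x. ennreal (\<bar>x\<bar> powr p) \<partial>two_point q b) = ennreal (\<bar>b\<bar> powr p * q)"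
  using assms by (simp add: nn_integral_two_point ennreal_mult)

lemma two_point_nonneg: "0 \<le> b \<Longrightarrow> AE x in two_point q b. 0 \<le> x"
  unfolding two_point_def by (subst AE_distr_iff) auto

lemma cdf_convolution_two_point:
  assumes "real_distribution \<nu>" "0 \<le> q" "q \<le> 1"
  shows "cdf (convolution (two_point q b) \<nu>) t = q * cdf \<nu> (t - b) + (1 - q) * cdf \<nu> t"
proof -
  interpret real_distribution \<nu> by fact
  note [measurable] = borel_measurable_cdf[OF assms(1)]
  have "emeasure (convolution (two_point q b) \<nu>) {..t}
      = ennreal (q * cdf \<nu> (t - b) + (1 - q) * cdf \<nu> t)"
    using assms by (simp add: emeasure_convolution_atMost real_distribution_two_point
        nn_integral_two_point ennreal_mult[symmetric] ennreal_plus[symmetric] cdf_nonneg mult.commute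
        del: ennreal_plus)
  then show ?thesis
    using assms by (subst cdf_def2) (intro measure_eq_emeasure_eq_ennreal, auto simp: cdf_nonneg)
qed

section \<open>Domination after adding Laplace noise\<close>

definition laplace_density :: "real \<Rightarrow> real \<Rightarrow> real" where
  "laplace_density s x = exp (- \<bar>x\<bar> / s) / (2 * s)"

definition laplace_law :: "real \<Rightarrow> real measure" where
  "laplace_law s = density lborel (laplace_density s)"

lemma laplace_density_measurable [measurable]: "laplace_density s \<in> borel_measurable borel"
  unfolding laplace_density_def by measurable

lemma laplace_density_nonneg: "s > 0 \<Longrightarrow> 0 \<le> laplace_density s x"
  by (simp add: laplace_density_def)

lemma nn_integral_laplace_density:
  assumes "s > 0"
  shows "(\<integral>\<^sup>+x. ennreal (laplace_density s x) \<partial>lborel) = 1"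
proof -
  let ?f = "\<lambda>x. ennreal (laplace_density s x)"
  have half: "(\<integral>\<^sup>+x. ?f x * indicator {0..} x \<partial>lborel) = ennreal (1/2)"
  proof -
    have "(\<integral>\<^sup>+x. ?f x * indicator {0..} x \<partial>lborel)
        = (\<integral>\<^sup>+x. ennreal (exp (- x / s) / (2 * s)) * indicator {0..} x \<partial>lborel)"
      by (intro nn_integral_cong) (auto simp: laplace_density_def split: split_indicator)
    also have "\<dots> = ennreal (0 - (- exp (- 0 / s) / 2))"
    proof (rule nn_integral_FTC_atLeast)
      show "((\<lambda>x. - exp (- x / s) / 2) has_real_derivative exp (- x / s) / (2 * s)) (at x)" for x
        using assms by (auto intro!: derivative_eq_intros simp: field_simps)
      show "((\<lambda>x. - exp (- x / s) / 2) \<longlongrightarrow> 0) at_top"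
        using assms by real_asymp
    qed (use assms in auto)
    finally show ?thesis by simp
  qed
  have "(\<integral>\<^sup>+x. ?f x * indicator {..<0} x \<partial>lborel)
      = (\<integral>\<^sup>+x. ?f (- x) * indicator {..<0} (- x) \<partial>lborel)"
    by (subst nn_integral_real_affine[where c = "-1" and t = 0]) auto
  also have "\<dots> = (\<integral>\<^sup>+x. ?f x * indicator {0..} x \<partial>lborel)"
    using AE_lborel_singleton[of "0::real"]
    by (intro nn_integral_cong_AE) (auto elim!: eventually_mono simp: laplace_density_def split: split_indicator)
  finally have neg: "(\<integral>\<^sup>+x. ?f x * indicator {..<0} x \<partial>lborel) = ennreal (1/2)" using half by simp
  have "(\<integral>\<^sup>+x. ?f x \<partial>lborel)
      = (\<integral>\<^sup>+x. ?f x * indicator {0..} x + ?f x * indicator {..<0} x \<partial>lborel)"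
    by (intro nn_integral_cong) (auto split: split_indicator)
  also have "\<dots> = ennreal (1/2) + ennreal (1/2)"
    by (subst nn_integral_add) (auto simp: half neg)
  also have "\<dots> = 1" by (subst ennreal_plus[symmetric]) auto
  finally show ?thesis .
qed

lemma real_distribution_laplace_law:
  assumes "s > 0"
  shows "real_distribution (laplace_law s)"
proof -
  have "prob_space (laplace_law s)"
    by (rule prob_spaceI)
      (simp add: laplace_law_def emeasure_density nn_integral_laplace_density[OF assms])
  then show ?thesis
    by (simp add: real_distribution_def real_distribution_axioms_def laplace_law_def)
qed

text \<open>
  Half of the exponential decay suffices to dominate the power: the weighted density is at most a
  multiple of the Laplace density of scale \<open>2 * s\<close>.
\<close>

lemma laplace_law_moment:
  assumes "s > 0" "0 \<le> p" "p < 1"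
  shows "laplace_law s \<in> borel_probs_moment p"
proof -
  have bound: "laplace_density s x * \<bar>x\<bar> powr p \<le> (2 + 4 * s) * laplace_density (2 * s) x" for x
  proof -
    have "\<bar>x\<bar> powr p \<le> 1 + \<bar>x\<bar>"
    proof (cases "\<bar>x\<bar> \<le> 1")
      case True
      then have "\<bar>x\<bar> powr p \<le> 1" using assms by (intro powr_le1) auto
      then show ?thesis by simp
    next
      case False
      then have "\<bar>x\<bar> powr p \<le> \<bar>x\<bar> powr 1" using assms by (intro powr_mono) auto
      then show ?thesis using False by simp
    qed
    also have "\<dots> \<le> (1 + 2 * s) * (1 + \<bar>x\<bar> / (2 * s))"
      using assms by (simp add: field_simps)
    also have "\<dots> \<le> (1 + 2 * s) * exp (\<bar>x\<bar> / (2 * s))"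
      using assms by (intro mult_left_mono exp_ge_add_one_self) auto
    finally have "laplace_density s x * \<bar>x\<bar> powr p
        \<le> laplace_density s x * ((1 + 2 * s) * exp (\<bar>x\<bar> / (2 * s)))"
      using assms by (intro mult_left_mono) (auto simp: laplace_density_def)
    also have "\<dots> = (2 + 4 * s) * laplace_density (2 * s) x"
    proof -
      have "exp (- \<bar>x\<bar> / s) * exp (\<bar>x\<bar> / (2 * s)) = exp (- \<bar>x\<bar> / (2 * s))"
        using assms by (simp add: exp_add[symmetric] field_simps)
      then show ?thesis using assms by (simp add: laplace_density_def field_simps)
    qed
    finally show ?thesis .
  qed
  have "(\<integral>\<^sup>+x. ennreal (\<bar>x\<bar> powr p) \<partial>laplace_law s)
      = (\<integral>\<^sup>+x. ennreal (laplace_density s x * \<bar>x\<bar> powr p) \<partial>lborel)"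
    using assms by (simp add: laplace_law_def nn_integral_density ennreal_mult laplace_density_nonneg)
  also have "\<dots> \<le> (\<integral>\<^sup>+x. ennreal (2 + 4 * s) * ennreal (laplace_density (2 * s) x) \<partial>lborel)"
    using assms bound by (intro nn_integral_mono)
      (simp add: ennreal_mult[symmetric] laplace_density_nonneg ennreal_leI del: ennreal_plus)
  also have "\<dots> = ennreal (2 + 4 * s)"
    using assms by (simp add: nn_integral_cmult nn_integral_laplace_density)
  also have "\<dots> < \<infinity>" by simp
  finally show ?thesis
    using real_distribution_laplace_law[OF assms(1)]
    by (simp add: borel_probs_moment_def borel_probs_def)
qed

lemma laplace_density_ratio:
  assumes "s > 0" "\<bar>x - y\<bar> \<le> s"
  shows "laplace_density s x \<le> 3 * laplace_density s y"
proof -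
  have "- \<bar>x\<bar> / s \<le> 1 + - \<bar>y\<bar> / s"
    using assms by (simp add: field_simps)
  then have "exp (- \<bar>x\<bar> / s) \<le> exp 1 * exp (- \<bar>y\<bar> / s)"
    by (simp add: exp_add[symmetric])
  also have "\<dots> \<le> 3 * exp (- \<bar>y\<bar> / s)"
    by (intro mult_right_mono exp_le) auto
  finally show ?thesis using assms by (simp add: laplace_density_def field_simps)
qed

text \<open>
  On an interval of length \<open>s\<close> the density stays within a factor 3 of its value at the right
  endpoint \<open>t\<close>. So the masses of the two intervals compare like their lengths \<open>a\<close> and \<open>s\<close>, up to
  a factor \<open>3 * 3\<close>.
\<close>

lemma laplace_law_interval_le:
  assumes "0 < a" "a \<le> s"
  shows "measure (laplace_law s) {t - a<..t} \<le> 9 * a / s * measure (laplace_law s) {t - s<..t}"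
proof -
  let ?c = "laplace_density s t"
  interpret real_distribution "laplace_law s"
    using assms by (intro real_distribution_laplace_law) auto
  have pos: "0 \<le> laplace_density s x" for x using assms by (simp add: laplace_density_def)
  have "ennreal (measure (laplace_law s) {t - a<..t})
      = (\<integral>\<^sup>+x. ennreal (laplace_density s x) * indicator {t - a<..t} x \<partial>lborel)"
    by (simp add: emeasure_eq_measure[symmetric]) (simp add: laplace_law_def emeasure_density)
  also have "\<dots> \<le> (\<integral>\<^sup>+x. ennreal (3 * ?c) * indicator {t - a<..t} x \<partial>lborel)"
    using assms by (intro nn_integral_mono)
      (auto intro!: ennreal_leI laplace_density_ratio split: split_indicator)
  also have "\<dots> = ennreal (3 * ?c * a)"
    using assms pos by (simp add: nn_integral_cmult_indicator ennreal_mult[symmetric])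
  finally have up: "measure (laplace_law s) {t - a<..t} \<le> 3 * ?c * a"
    using assms pos by (simp add: ennreal_le_iff)
  have "ennreal (?c / 3 * s) = (\<integral>\<^sup>+x. ennreal (?c / 3) * indicator {t - s<..t} x \<partial>lborel)"
    using assms pos by (simp add: nn_integral_cmult_indicator ennreal_mult[symmetric])
  also have "\<dots> \<le> (\<integral>\<^sup>+x. ennreal (laplace_density s x) * indicator {t - s<..t} x \<partial>lborel)"
  proof (intro nn_integral_mono)
    fix x
    have "?c / 3 \<le> laplace_density s x" if "x \<in> {t - s<..t}"
      using laplace_density_ratio[of s t x] that assms by simp
    then show "ennreal (?c / 3) * indicator {t - s<..t} x
        \<le> ennreal (laplace_density s x) * indicator {t - s<..t} x"
      by (auto intro!: ennreal_leI split: split_indicator)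
  qed
  also have "\<dots> = ennreal (measure (laplace_law s) {t - s<..t})"
    by (simp add: emeasure_eq_measure[symmetric]) (simp add: laplace_law_def emeasure_density)
  finally have low: "?c / 3 * s \<le> measure (laplace_law s) {t - s<..t}"
    by (simp add: ennreal_le_iff)
  have "3 * ?c * a = 9 * a / s * (?c / 3 * s)" using assms by simp
  also have "\<dots> \<le> 9 * a / s * measure (laplace_law s) {t - s<..t}"
    using assms low by (intro mult_left_mono) auto
  finally show ?thesis using up by linarith
qed

text \<open>
  With \<open>F\<close> for the distribution function of the noise and \<open>q = 9 * a / s\<close>, domination says
  \<open>q * F (t - s) + (1 - q) * F t \<le> F (t - a)\<close>. This is a rearrangement of
  \<open>F t - F (t - a) \<le> q * (F t - F (t - s))\<close>, the preceding comparison of masses.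
\<close>

lemma two_point_dominates_with_noise:
  assumes "0 < a" "9 * a \<le> s"
  shows "stochastic_le (convolution (return borel a) (laplace_law s))
      (convolution (two_point (9 * a / s) s) (laplace_law s))"
  unfolding stochastic_le_def
proof
  fix t
  have L: "real_distribution (laplace_law s)"
    using assms by (intro real_distribution_laplace_law) auto
  interpret real_distribution "laplace_law s" by fact
  let ?F = "cdf (laplace_law s)"
  have "?F t - ?F (t - a) \<le> 9 * a / s * (?F t - ?F (t - s))"
    using laplace_law_interval_le[of a s t] assms by (simp add: cdf_diff_eq)
  then have "9 * a / s * ?F (t - s) + (1 - 9 * a / s) * ?F t \<le> ?F (t - a)"
    by (simp add: algebra_simps)
  then show "cdf (convolution (two_point (9 * a / s) s) (laplace_law s)) t
      \<le> cdf (convolution (return borel a) (laplace_law s)) t"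
    using assms by (simp add: cdf_convolution_two_point[OF L] cdf_convolution_return[OF L])
qed

section \<open>Reflection\<close>

definition reflect :: "real measure \<Rightarrow> real measure" where
  "reflect \<mu> = distr \<mu> borel uminus"

lemma reflect_in_borel_probs_moment:
  assumes "\<mu> \<in> borel_probs_moment p"
  shows "reflect \<mu> \<in> borel_probs_moment p"
proof -
  interpret real_distribution \<mu> using assms by (rule real_distribution_moment)
  show ?thesis
    unfolding reflect_def using assms
    by (intro distr_in_borel_probs_moment prob_space_axioms)
      (auto simp: borel_probs_moment_def)
qed

lemma reflect_reflect:
  assumes "real_distribution \<mu>"
  shows "reflect (reflect \<mu>) = \<mu>"
proof -
  interpret real_distribution \<mu> by fact
  show ?thesis by (simp add: reflect_def distr_distr o_def distr_id2)
qed

lemma reflect_convolution: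
  assumes "real_distribution \<mu>" "real_distribution \<nu>"
  shows "reflect (convolution \<mu> \<nu>) = convolution (reflect \<mu>) (reflect \<nu>)"
proof (rule measure_eqI)
  interpret M: real_distribution \<mu> by fact
  interpret N: real_distribution \<nu> by fact
  fix A assume "A \<in> sets (reflect (convolution \<mu> \<nu>))"
  then have A [measurable]: "A \<in> sets borel" by (simp add: reflect_def)
  have fin: "finite_measure (reflect \<mu>)" "finite_measure (reflect \<nu>)"
    by (auto simp: reflect_def intro!: M.finite_measure_distr N.finite_measure_distr)
  have "emeasure (reflect (convolution \<mu> \<nu>)) A
      = (\<integral>\<^sup>+x. indicator A x \<partial>reflect (convolution \<mu> \<nu>))"
    by (simp add: reflect_def)
  also have "\<dots> = (\<integral>\<^sup>+x. \<integral>\<^sup>+y. indicator A (- (x + y)) \<partial>\<nu> \<partial>\<mu>)"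
    unfolding reflect_def
    by (subst nn_integral_distr)
      (auto simp: nn_integral_convolution M.finite_measure_axioms N.finite_measure_axioms)
  also have "\<dots> = (\<integral>\<^sup>+x. \<integral>\<^sup>+y. indicator A (x + y) \<partial>reflect \<nu> \<partial>reflect \<mu>)"
    by (simp add: reflect_def nn_integral_distr)
  also have "\<dots> = emeasure (convolution (reflect \<mu>) (reflect \<nu>)) A"
    by (rule convolution_emeasure'[symmetric]) (use fin in \<open>auto simp: reflect_def\<close>)
  finally show "emeasure (reflect (convolution \<mu> \<nu>)) A
      = emeasure (convolution (reflect \<mu>) (reflect \<nu>)) A" .
qed (simp add: reflect_def)

text \<open>
  Reflection turns the masses of closed half-lines \<open>{..t}\<close> into masses of complements of open
  half-lines. The order also compares the open half-lines, whose masses are left limits of the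
  distribution functions.
\<close>

lemma stochastic_le_reflect:
  assumes "real_distribution \<mu>" "real_distribution \<nu>" and le: "stochastic_le \<mu> \<nu>"
  shows "stochastic_le (reflect \<nu>) (reflect \<mu>)"
  unfolding stochastic_le_def
proof
  fix t
  interpret M: real_distribution \<mu> by fact
  interpret N: real_distribution \<nu> by fact
  have "measure \<nu> {..< -t} \<le> measure \<mu> {..< -t}"
    by (rule tendsto_le[OF _ M.cdf_at_left N.cdf_at_left])
      (use le in \<open>auto simp: stochastic_le_def\<close>)
  moreover have "cdf (reflect \<rho>) t = 1 - measure \<rho> {..< -t}" if "real_distribution \<rho>" for \<rho>
  proof -
    interpret real_distribution \<rho> by fact
    have "cdf (reflect \<rho>) t = measure \<rho> (uminus -` {..t})"
      by (simp add: cdf_def reflect_def measure_distr)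
    also have "uminus -` {..t} = space \<rho> - {..< -t}" by auto
    also have "measure \<rho> \<dots> = 1 - measure \<rho> {..< -t}" by (rule prob_compl) simp
    finally show ?thesis .
  qed
  ultimately show "cdf (reflect \<mu>) t \<le> cdf (reflect \<nu>) t" using assms by simp
qed

section \<open>Vanishing of monotone additive statistics\<close>

definition upper_part :: "real \<Rightarrow> real measure \<Rightarrow> real measure" where
  "upper_part M \<mu> = distr \<mu> borel (\<lambda>x. if M < x then x else 0)"

locale monotone_additive_on_moments =
  fixes p :: real and \<phi> :: "real measure \<Rightarrow> real"
  assumes p: "0 \<le> p" "p < 1"
    and statistic: "monotone_additive_statistic (borel_probs_moment p) \<phi>"
begin

lemma statistic_mono:
  "\<mu> \<in> borel_probs_moment p \<Longrightarrow> \<nu> \<in> borel_probs_moment p \<Longrightarrow> stochastic_le \<mu> \<nu> \<Longrightarrow> \<phi> \<mu> \<le> \<phi> \<nu>"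
  using statistic by (simp add: monotone_additive_statistic_def monotone_statistic_def)

lemma statistic_convolution:
  "\<mu> \<in> borel_probs_moment p \<Longrightarrow> \<nu> \<in> borel_probs_moment p
    \<Longrightarrow> \<phi> (convolution \<mu> \<nu>) = \<phi> \<mu> + \<phi> \<nu>"
  using statistic by (simp add: monotone_additive_statistic_def additive_statistic_def)

lemma convolution_in_moment:
  "\<mu> \<in> borel_probs_moment p \<Longrightarrow> \<nu> \<in> borel_probs_moment p
    \<Longrightarrow> convolution \<mu> \<nu> \<in> borel_probs_moment p"
  using p sub_semigroup_borel_probs sub_semigroup_borel_probs_moment[of p]
  by (cases "p = 0") (auto simp: borel_probs_eq_moment_0 sub_semigroup_def)

text \<open>
  The law of the infinite sum of independent variables with laws \<open>\<mu> i\<close> lies in the moment class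
  and dominates the law of each partial sum. Its statistic is therefore at least \<open>n * a\<close> for all
  \<open>n > 0\<close>, and being a real number it forces \<open>a \<le> 0\<close>.
\<close>

lemma statistic_bound_of_summable_moments:
  fixes \<mu> :: "nat \<Rightarrow> real measure"
  assumes \<mu>: "\<And>i. \<mu> i \<in> borel_probs_moment p"
    and nonneg: "\<And>i. AE x in \<mu> i. 0 \<le> x"
    and sum: "(\<Sum>i. \<integral>\<^sup>+x. ennreal (\<bar>x\<bar> powr p) \<partial>\<mu> i) < \<infinity>"
    and a: "\<And>i. a \<le> \<phi> (\<mu> i)"
  shows "a \<le> 0"
proof -
  have rd: "real_distribution (\<mu> i)" for i by (rule real_distribution_moment[OF \<mu>])
  then have prob: "prob_space (\<mu> i)" and sets_\<mu>: "sets (\<mu> i) = sets borel" for i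
    by (auto simp: real_distribution_def real_distribution_axioms_def)
  define P where "P = Pi\<^sub>M UNIV \<mu>"
  interpret P: prob_space P unfolding P_def by (rule prob_space_PiM[OF prob])
  have [measurable]: "(\<lambda>\<omega>. \<omega> i) \<in> borel_measurable P" for i
  proof -
    have "(\<lambda>\<omega>. \<omega> i) \<in> measurable P (\<mu> i)"
      unfolding P_def by (rule measurable_component_singleton) simp
    then show ?thesis by (simp add: measurable_cong_sets[OF refl sets_\<mu>])
  qed
  have law: "distr P borel (\<lambda>\<omega>. \<omega> i) = \<mu> i" for i
  proof -
    have "distr P borel (\<lambda>\<omega>. \<omega> i) = distr P (\<mu> i) (\<lambda>\<omega>. \<omega> i)"
      by (rule distr_cong) (simp_all add: sets_\<mu>)
    also have "\<dots> = \<mu> i"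
      unfolding P_def by (rule distr_PiM_component) (simp_all add: prob)
    finally show ?thesis .
  qed
  have indep: "P.indep_vars (\<lambda>_. borel) (\<lambda>i \<omega>. \<omega> i) UNIV"
  proof -
    have "sets (Pi\<^sub>M UNIV (\<lambda>_::nat. borel :: real measure)) = sets P"
      unfolding P_def by (intro sets_PiM_cong) (auto simp: sets_\<mu>)
    moreover have "(\<lambda>\<omega>::nat \<Rightarrow> real. restrict \<omega> UNIV) = (\<lambda>\<omega>. \<omega>)"
      by (simp add: restrict_def)
    ultimately show ?thesis
      by (subst P.indep_vars_iff_distr_eq_PiM) (auto simp: law distr_id2 P_def[symmetric])
  qed

  \<comment> \<open>The partial sums are nonempty, so that the induction starts from \<open>\<mu> 0\<close>.\<close>
  have partial: "distr P borel (\<lambda>\<omega>. \<Sum>i<Suc n. \<omega> i) \<in> borel_probs_moment p \<and>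
      real (Suc n) * a \<le> \<phi> (distr P borel (\<lambda>\<omega>. \<Sum>i<Suc n. \<omega> i))" for n
  proof (induction n)
    case 0
    then show ?case using \<mu> a by (simp add: law)
  next
    case (Suc n)
    have "P.indep_var borel (\<lambda>\<omega>. \<omega> (Suc n)) borel (\<lambda>\<omega>. \<Sum>i<Suc n. \<omega> i)"
      by (rule P.indep_vars_sum) (auto intro: P.indep_vars_subset[OF indep])
    then have "distr P borel (\<lambda>\<omega>. \<omega> (Suc n) + (\<Sum>i<Suc n. \<omega> i))
        = convolution (distr P borel (\<lambda>\<omega>. \<omega> (Suc n))) (distr P borel (\<lambda>\<omega>. \<Sum>i<Suc n. \<omega> i))"
      by (rule P.sum_indep_random_variable) measurable
    then have eq: "distr P borel (\<lambda>\<omega>. \<Sum>i<Suc (Suc n). \<omega> i)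
        = convolution (\<mu> (Suc n)) (distr P borel (\<lambda>\<omega>. \<Sum>i<Suc n. \<omega> i))"
      by (simp only: law sum.lessThan_Suc[of _ "Suc n"] add.commute)
    have "real (Suc (Suc n)) * a = a + real (Suc n) * a" by (simp add: algebra_simps)
    then show ?case unfolding eq
      using Suc \<mu>[of "Suc n"] a[of "Suc n"] by (simp add: convolution_in_moment statistic_convolution)
  qed

  define T where "T \<omega> = (\<Sum>i. \<omega> i)" for \<omega> :: "nat \<Rightarrow> real"
  have [measurable]: "T \<in> borel_measurable P" unfolding T_def by measurable
  have moments: "(\<integral>\<^sup>+\<omega>. (\<Sum>i. ennreal (\<bar>\<omega> i\<bar> powr p)) \<partial>P) < \<infinity>"
  proof -
    have "(\<integral>\<^sup>+\<omega>. ennreal (\<bar>\<omega> i\<bar> powr p) \<partial>P) = (\<integral>\<^sup>+x. ennreal (\<bar>x\<bar> powr p) \<partial>\<mu> i)" for i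
      by (subst law[symmetric]) (simp add: nn_integral_distr)
    then show ?thesis using sum by (simp add: nn_integral_suminf)
  qed
  have "AE \<omega> in P. (\<Sum>i. ennreal (\<bar>\<omega> i\<bar> powr p)) \<noteq> \<infinity>"
    by (rule nn_integral_PInf_AE) (use moments in auto)
  moreover have "AE \<omega> in P. \<forall>i. 0 \<le> \<omega> i"
    unfolding AE_all_countable P_def by (intro allI AE_PiM_component prob nonneg) auto
  ultimately have good: "AE \<omega> in P. (\<forall>i. 0 \<le> \<omega> i) \<and> summable (\<lambda>i. \<omega> i powr p)"
  proof eventually_elim
    case (elim \<omega>)
    then have "summable (\<lambda>i. \<bar>\<omega> i\<bar> powr p)" by (intro summable_suminf_not_top) auto
    then show ?case using elim by simp
  qed
  have "AE \<omega> in P. ennreal (\<bar>T \<omega>\<bar> powr p) \<le> (\<Sum>i. ennreal (\<bar>\<omega> i\<bar> powr p))"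
    using good
  proof eventually_elim
    case (elim \<omega>)
    then have "summable \<omega>" using summable_of_summable_powr[of p \<omega>] p by simp
    then have "0 \<le> T \<omega>" unfolding T_def using elim by (intro suminf_nonneg) auto
    then show ?case
      using elim suminf_powr_le[of p \<omega>] p by (simp add: T_def suminf_ennreal2 ennreal_leI)
  qed
  then have "(\<integral>\<^sup>+\<omega>. ennreal (\<bar>T \<omega>\<bar> powr p) \<partial>P) < \<infinity>"
    by (rule le_less_trans[OF nn_integral_mono_AE moments])
  then have TS: "distr P borel T \<in> borel_probs_moment p"
    by (intro distr_in_borel_probs_moment P.prob_space_axioms) auto

  have bound: "real (Suc n) * a \<le> \<phi> (distr P borel T)" for n
  proof -
    have "AE \<omega> in P. (\<Sum>i<Suc n. \<omega> i) \<le> T \<omega>"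
      using good
    proof eventually_elim
      case (elim \<omega>)
      then have "summable \<omega>" using summable_of_summable_powr[of p \<omega>] p by simp
      then show ?case unfolding T_def using elim by (intro sum_le_suminf) auto
    qed
    then have "stochastic_le (distr P borel (\<lambda>\<omega>. \<Sum>i<Suc n. \<omega> i)) (distr P borel T)"
      by (intro stochastic_le_coupling P.prob_space_axioms) auto
    then show ?thesis
      using partial[of n] TS statistic_mono by (meson order_trans)
  qed
  show "a \<le> 0"
  proof (rule ccontr)
    assume "\<not> a \<le> 0"
    then obtain n where "\<phi> (distr P borel T) < real n * a"
      using reals_Archimedean3[of a] by auto
    also have "\<dots> \<le> real (Suc n) * a" using \<open>\<not> a \<le> 0\<close> by simp
    finally show False using bound[of n] by simp
  qed
qed

text \<open>
  The statistic of \<open>a\<close> is at most that of the two-point law with values 0 and \<open>s i\<close>, by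
  cancellation of the Laplace noise. With \<open>s i\<close> proportional to \<open>2 ^ i\<close>, the moments of these
  laws form a geometric series with ratio \<open>2 powr (p - 1)\<close>.
\<close>

lemma statistic_return_nonpos:
  assumes "a > 0"
  shows "\<phi> (return borel a) \<le> 0"
proof (rule statistic_bound_of_summable_moments)
  \<comment> \<open>The constant 9 is that of the domination lemma; it makes the probability \<open>9 * a / s i\<close>
      equal to \<open>1 / 2 ^ i\<close>.\<close>
  define s where "s i = 9 * a * 2 ^ i" for i :: nat
  let ?\<mu> = "\<lambda>i. two_point (9 * a / s i) (s i)"
  have s: "0 < s i" "9 * a \<le> s i" for i
    using assms by (auto simp: s_def)
  have moment: "(\<integral>\<^sup>+x. ennreal (\<bar>x\<bar> powr p) \<partial>?\<mu> i)
      = ennreal ((9 * a) powr p * (2 powr (p - 1)) ^ i)" for i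
  proof -
    have "\<bar>s i\<bar> powr p * (9 * a / s i) = (9 * a) powr p * ((2 powr p) ^ i / 2 ^ i)"
      using assms by (simp add: s_def abs_mult powr_mult powr_power powr_realpow[symmetric] powr_powr mult.commute)
    also have "(2 powr p) ^ i / 2 ^ i = (2 powr (p - 1) :: real) ^ i"
      by (simp add: powr_diff power_divide)
    finally show ?thesis using s[of i] assms by (simp add: nn_integral_two_point_powr)
  qed
  show S: "?\<mu> i \<in> borel_probs_moment p" for i
    using moment[of i] real_distribution_two_point
    by (simp add: borel_probs_moment_def borel_probs_def)
  show "AE x in ?\<mu> i. 0 \<le> x" for i
    using s[of i] by (intro two_point_nonneg) auto
  have "(2::real) powr (p - 1) < 2 powr 0" using p by (intro powr_less_mono) auto
  then have "summable (\<lambda>i. (9 * a) powr p * (2 powr (p - 1)) ^ i)"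
    by (intro summable_mult summable_geometric) auto
  then show "(\<Sum>i. \<integral>\<^sup>+x. ennreal (\<bar>x\<bar> powr p) \<partial>?\<mu> i) < \<infinity>"
    unfolding moment by (subst suminf_ennreal2) auto
  show "\<phi> (return borel a) \<le> \<phi> (?\<mu> i)" for i
  proof -
    let ?L = "laplace_law (s i)"
    have L: "?L \<in> borel_probs_moment p" using s p by (intro laplace_law_moment) auto
    have "\<phi> (convolution (return borel a) ?L) \<le> \<phi> (convolution (?\<mu> i) ?L)"
      using assms s L S
      by (intro statistic_mono convolution_in_moment return_in_moment two_point_dominates_with_noise)
    then show ?thesis using L S by (simp add: statistic_convolution return_in_moment)
  qed
qed

text \<open>
  For \<open>M > 0\<close> every real \<open>x\<close> is at most \<open>M\<close> plus its part above \<open>M\<close>, and adding the constant \<open>M\<close>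
  does not increase the statistic. So the part above \<open>M\<close> keeps at least the statistic of \<open>\<mu>\<close>,
  however small its moment becomes as \<open>M\<close> grows.
\<close>

lemma statistic_nonpos:
  assumes \<mu>: "\<mu> \<in> borel_probs_moment p"
  shows "\<phi> \<mu> \<le> 0"
proof -
  have rd: "real_distribution \<mu>" by (rule real_distribution_moment[OF \<mu>])
  interpret real_distribution \<mu> by fact
  have fin: "(\<integral>\<^sup>+x. ennreal (\<bar>x\<bar> powr p) \<partial>\<mu>) < \<infinity>" using \<mu> by (simp add: borel_probs_moment_def)
  have moment: "(\<integral>\<^sup>+x. ennreal (\<bar>x\<bar> powr p) \<partial>upper_part M \<mu>)
      = (\<integral>\<^sup>+x. ennreal (\<bar>if M < x then x else 0\<bar> powr p) \<partial>\<mu>)" for M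
    by (simp add: upper_part_def nn_integral_distr)
  have S: "upper_part M \<mu> \<in> borel_probs_moment p" for M
    unfolding upper_part_def
  proof (intro distr_in_borel_probs_moment prob_space_axioms)
    have "(\<integral>\<^sup>+x. ennreal (\<bar>if M < x then x else 0\<bar> powr p) \<partial>\<mu>) \<le> (\<integral>\<^sup>+x. ennreal (\<bar>x\<bar> powr p) \<partial>\<mu>)"
      by (intro nn_integral_mono) auto
    then show "(\<integral>\<^sup>+x. ennreal (\<bar>if M < x then x else 0\<bar> powr p) \<partial>\<mu>) < \<infinity>"
      using fin by (rule le_less_trans)
  qed auto
  have mono: "\<phi> \<mu> \<le> \<phi> (upper_part M \<mu>)" if "M > 0" for M
  proof -
    have "stochastic_le \<mu> (convolution (return borel M) (upper_part M \<mu>))"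
      unfolding stochastic_le_def
    proof
      fix t
      have "cdf (upper_part M \<mu>) (t - M) = measure \<mu> {x. (if M < x then x else 0) \<le> t - M}"
        by (simp add: cdf_def upper_part_def measure_distr vimage_def)
      also have "\<dots> \<le> cdf \<mu> t"
        unfolding cdf_def using that by (intro finite_measure_mono) (auto split: if_splits)
      finally show "cdf (convolution (return borel M) (upper_part M \<mu>)) t \<le> cdf \<mu> t"
        by (simp add: cdf_convolution_return real_distribution_moment[OF S])
    qed
    then have "\<phi> \<mu> \<le> \<phi> (convolution (return borel M) (upper_part M \<mu>))"
      by (intro statistic_mono \<mu> convolution_in_moment return_in_moment S)
    then show ?thesis
      using statistic_return_nonpos[OF that] by (simp add: statistic_convolution return_in_moment S)
  qed
  have "(\<lambda>n. \<integral>\<^sup>+x. ennreal (\<bar>if real n < x then x else 0\<bar> powr p) \<partial>\<mu>) \<longlonglongrightarrow> (\<integral>\<^sup>+x. 0 \<partial>\<mu>)"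
  proof (rule nn_integral_dominated_convergence[where w = "\<lambda>x. ennreal (\<bar>x\<bar> powr p)"])
    show "AE x in \<mu>. (\<lambda>n. ennreal (\<bar>if real n < x then x else 0\<bar> powr p)) \<longlonglongrightarrow> 0"
    proof (intro AE_I2)
      fix x :: real
      have "eventually (\<lambda>n. x \<le> real n) sequentially"
        using eventually_ge_at_top[of "nat \<lceil>x\<rceil>"] by eventually_elim linarith
      then have "eventually (\<lambda>n. ennreal (\<bar>if real n < x then x else 0\<bar> powr p) = 0) sequentially"
        by eventually_elim auto
      then show "(\<lambda>n. ennreal (\<bar>if real n < x then x else 0\<bar> powr p)) \<longlonglongrightarrow> 0"
        by (rule tendsto_eventually)
    qed
  qed (use fin in auto)
  then have lim: "(\<lambda>n. \<integral>\<^sup>+x. ennreal (\<bar>x\<bar> powr p) \<partial>upper_part (real n) \<mu>) \<longlonglongrightarrow> 0"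
    by (simp add: moment)
  have "\<exists>n. 0 < n \<and> (\<integral>\<^sup>+x. ennreal (\<bar>x\<bar> powr p) \<partial>upper_part (real n) \<mu>) < ennreal ((1/2) ^ i)"
    for i :: nat
  proof -
    have "eventually (\<lambda>n. (\<integral>\<^sup>+x. ennreal (\<bar>x\<bar> powr p) \<partial>upper_part (real n) \<mu>) < ennreal ((1/2) ^ i))
        sequentially"
      by (rule order_tendstoD(2)[OF lim]) simp
    with eventually_gt_at_top[of 0] show ?thesis
      using eventually_happens'[OF sequentially_bot] eventually_conj by blast
  qed
  then obtain N where N: "\<And>i. 0 < N i"
    and small: "\<And>i. (\<integral>\<^sup>+x. ennreal (\<bar>x\<bar> powr p) \<partial>upper_part (real (N i)) \<mu>) < ennreal ((1/2) ^ i)"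
    by metis
  show ?thesis
  proof (rule statistic_bound_of_summable_moments)
    show "upper_part (real (N i)) \<mu> \<in> borel_probs_moment p" for i by (rule S)
    show "AE x in upper_part (real (N i)) \<mu>. 0 \<le> x" for i
      unfolding upper_part_def by (subst AE_distr_iff) auto
    have "(\<Sum>i. \<integral>\<^sup>+x. ennreal (\<bar>x\<bar> powr p) \<partial>upper_part (real (N i)) \<mu>) \<le> (\<Sum>i. ennreal ((1/2) ^ i))"
      by (intro suminf_le less_imp_le[OF small]) auto
    also have "\<dots> < \<infinity>" by (subst suminf_ennreal2) (auto intro: summable_geometric)
    finally show "(\<Sum>i. \<integral>\<^sup>+x. ennreal (\<bar>x\<bar> powr p) \<partial>upper_part (real (N i)) \<mu>) < \<infinity>" .
    show "\<phi> \<mu> \<le> \<phi> (upper_part (real (N i)) \<mu>)" for i using N by (intro mono) simp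
  qed
qed

lemma reflected_statistic: "monotone_additive_on_moments p (\<lambda>\<mu>. - \<phi> (reflect \<mu>))"
proof
  show "monotone_additive_statistic (borel_probs_moment p) (\<lambda>\<mu>. - \<phi> (reflect \<mu>))"
    unfolding monotone_additive_statistic_def monotone_statistic_def additive_statistic_def
    by (auto simp: reflect_convolution real_distribution_moment statistic_convolution
        reflect_in_borel_probs_moment intro!: statistic_mono stochastic_le_reflect)
qed (rule p)+

lemma statistic_eq_0:
  assumes "\<mu> \<in> borel_probs_moment p"
  shows "\<phi> \<mu> = 0"
proof (rule antisym)
  interpret reflected: monotone_additive_on_moments p "\<lambda>\<mu>. - \<phi> (reflect \<mu>)"
    by (rule reflected_statistic)
  have "- \<phi> (reflect (reflect \<mu>)) \<le> 0"
    by (intro reflected.statistic_nonpos reflect_in_borel_probs_moment assms)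
  then show "0 \<le> \<phi> \<mu>" using assms by (simp add: reflect_reflect real_distribution_moment)
qed (rule statistic_nonpos[OF assms])

end

theorem theorem2:
  fixes S :: "real measure set" and \<phi> :: "real measure \<Rightarrow> real"
  assumes "S = borel_probs \<or> (\<exists>p::real. 0 < p \<and> p < 1 \<and> S = borel_probs_moment p)"
  shows "monotone_additive_statistic S \<phi> \<longleftrightarrow> (\<forall>\<mu>\<in>S. \<phi> \<mu> = 0)"
proof
  obtain p where p: "0 \<le> p" "p < 1" and S: "S = borel_probs_moment p"
    using assms borel_probs_eq_moment_0 by (metis less_imp_le order_refl zero_less_one)
  assume "monotone_additive_statistic S \<phi>"
  then interpret monotone_additive_on_moments p \<phi>
    using p S by unfold_locales auto
  show "\<forall>\<mu>\<in>S. \<phi> \<mu> = 0" by (simp add: S statistic_eq_0)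
next
  have "sub_semigroup S"
    using assms sub_semigroup_borel_probs sub_semigroup_borel_probs_moment by auto
  moreover assume "\<forall>\<mu>\<in>S. \<phi> \<mu> = 0"
  ultimately show "monotone_additive_statistic S \<phi>"
    by (auto simp: monotone_additive_statistic_def monotone_statistic_def
        additive_statistic_def sub_semigroup_def)
qed

end
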